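(* Let $p\in[0,1]$. For each integer $t\ge 1$, choose a random block of length $2t+2$ over $\{0,1\}$ whose entries are independent, each equal to 1 with probability $p$ and to 0 with probability $1-p$, and let $P_t(00)$ be the probability that this block is a $t$-step preimage of the block $00$ under rule 184. Then the limit $P_\infty(00)=\lim_{t\to\infty}P_t(00)$ exists and $$P_{\infty}(00)=\begin{cases}1-2p & \text{if } p<\tfrac12,\\ 0 & \text{otherwise.}\end{cases}$$
   Context: Rule 184 is the map $f:\{0,1\}^3\to\{0,1\}$ given by $000\mapsto 0$, $001\mapsto 0$, $010\mapsto 0$, $011\mapsto 1$, $100\mapsto 1$, $101\mapsto 1$, $110\mapsto 0$, $111\mapsto 1$. Its block evolution operator $\mathbf{f}$ maps a block $b_1b_2\ldots b_n$ (with $n>2$, $b_i\in\{0,1\}$) to the block of length $n-2$ given by $f(b_1,b_2,b_3)f(b_2,b_3,b_4)\ldots f(b_{n-2},b_{n-1},b_n)$. A block $b$ of length $k+2t$ is a $t$-step preimage of a block $a$ of length $k$ if $\mathbf{f}^t(b)=a$, where $\mathbf{f}^t$ denotes $\mathbf{f}$ iterated $t$ times. *)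

theory Defs
  imports "HOL-Probability.Probability"
begin

text \<open>The alphabet \<open>{0,1}\<close> is \<^typ>\<open>bool\<close>, with \<^term>\<open>True\<close> for \<open>1\<close>.\<close>

fun rule184 :: "bool \<Rightarrow> bool \<Rightarrow> bool \<Rightarrow> bool" where
  "rule184 False False False = False"
| "rule184 False False True  = False"
| "rule184 False True  False = False"
| "rule184 False True  True  = True"
| "rule184 True  False False = True"
| "rule184 True  False True  = True"
| "rule184 True  True  False = False"
| "rule184 True  True  True  = True"

text \<open>Indices start at \<open>0\<close>. Blocks of length at most \<open>2\<close> are sent to the empty block.\<close>

definition block_evolution :: "(bool \<Rightarrow> bool \<Rightarrow> bool \<Rightarrow> bool) \<Rightarrow> bool list \<Rightarrow> bool list" where
  "block_evolution f b = map (\<lambda>i. f (b ! i) (b ! (i + 1)) (b ! (i + 2))) [0..<length b - 2]"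

definition is_preimage ::
  "(bool \<Rightarrow> bool \<Rightarrow> bool \<Rightarrow> bool) \<Rightarrow> nat \<Rightarrow> bool list \<Rightarrow> bool list \<Rightarrow> bool" where
  "is_preimage f t a b \<longleftrightarrow> length b = length a + 2 * t \<and> (block_evolution f ^^ t) b = a"

definition preimage_prob :: "real \<Rightarrow> nat \<Rightarrow> bool list \<Rightarrow> real" where
  "preimage_prob p t a =
     measure_pmf.prob (replicate_pmf (length a + 2 * t) (bernoulli_pmf p))
       {b. is_preimage rule184 t a b}"

end

theory Submission
  imports Defs
begin

text \<open>
  Two adjacent zeros travel to the right at unit speed and annihilate with pairs of adjacent ones
  travelling to the left. Hence a block is a \<open>t\<close>-step preimage of \<open>00\<close> iff in each of its nonempty
  prefixes the zeros outnumber the ones, a property that one step of the rule preserves and reflects.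
  So the probability in question is that of a random walk, stepping up with probability \<open>1 - p\<close> and
  down with probability \<open>p\<close>, staying positive for \<open>2t + 2\<close> steps. The limiting survival
  probability is harmonic in the starting height, which makes it a multiple of \<open>\<Sum>i<h. (p / (1 - p))^i\<close>;
  boundedness and the martingale bound \<open>1 - (p / (1 - p))^h\<close> determine the factor.
\<close>

text \<open>Truncated subtraction is harmless: a step is only taken from a positive height.\<close>

fun stays_positive :: "nat \<Rightarrow> bool list \<Rightarrow> bool" where
  "stays_positive h [] \<longleftrightarrow> 0 < h"
| "stays_positive h (x # xs) \<longleftrightarrow> 0 < h \<and> stays_positive (if x then h - 1 else h + 1) xs"

lemma stays_positive_imp_pos: "stays_positive h xs \<Longrightarrow> 0 < h"
  by (cases xs) auto

lemma not_stays_positive_0 [simp]: "\<not> stays_positive 0 xs"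
  by (cases xs) auto

lemma length_block_evolution [simp]: "length (block_evolution f b) = length b - 2"
  by (simp add: block_evolution_def)

lemma block_evolution_short [simp]:
  "block_evolution f [] = []" "block_evolution f [x] = []" "block_evolution f [x, y] = []"
  by (simp_all add: block_evolution_def)

lemma block_evolution_Cons [simp]:
  "block_evolution f (x # y # z # zs) = f x y z # block_evolution f (y # z # zs)"
  by (simp add: block_evolution_def map_upt_Suc del: upt_Suc)

text \<open>
  The number of ones is conserved up to the flux across the boundary bonds. Hence, once the original
  walk has read two initial zeros and further sites up to \<open>x\<close> and stands at height \<open>h\<close>, the image
  walk stands at \<open>h - 1\<close> plus twice the flux from \<open>x\<close> to its right neighbour \<open>y\<close>.
\<close>
lemma stays_positive_block_evolution_aux:
  assumes "0 < h" "0 < (if x \<and> \<not> y then h + 1 else h - 1)"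
  shows "stays_positive (if x \<and> \<not> y then h + 1 else h - 1) (block_evolution rule184 (x # y # ys))
    \<longleftrightarrow> stays_positive h (y # ys)"
  using assms
proof (induction ys arbitrary: h x y)
  case Nil
  then show ?case by (auto split: if_splits)
next
  case (Cons z zs)
  have "0 < (if y then h - 1 else h + 1)"
    using Cons.prems by (auto split: if_splits)
  \<comment> \<open>The remaining premise of the induction hypothesis fails only if \<open>y\<close>
    and \<open>z\<close> are ones and \<open>h = 2\<close>; then both walks hit 0.\<close>
  from Cons.IH[OF this, of y z] Cons.prems show ?case
    by (cases x; cases y; cases z; cases "h - Suc (Suc 0)") (auto dest: stays_positive_imp_pos)
qed

text \<open>The walk starts at height 0, which \<open>stays_positive\<close> rejects, so the first
  cell is split off.\<close>

definition zeros_lead :: "bool list \<Rightarrow> bool" where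
  "zeros_lead b \<longleftrightarrow> (\<exists>xs. b = False # xs \<and> stays_positive 1 xs)"

text \<open>After an initial 00 this is the flux argument at height 2. For any other start both
  sides are false, as the image begins with 1 or 01; seeing two image cells takes length 4.\<close>

lemma zeros_lead_block_evolution:
  assumes "4 \<le> length b"
  shows "zeros_lead (block_evolution rule184 b) \<longleftrightarrow> zeros_lead b"
proof -
  obtain w x y z zs where b: "b = w # x # y # z # zs"
    using assms by (auto simp: numeral_eq_Suc Suc_le_length_iff)
  show ?thesis
    using stays_positive_block_evolution_aux[of 2 False y "z # zs"]
    unfolding b zeros_lead_def
    by (cases w; cases x; cases y; cases z) (auto simp: numeral_eq_Suc)
qed

lemma block_evolution_funpow_eq_00_iff:
  assumes "length b = 2 + 2 * t"
  shows "(block_evolution rule184 ^^ t) b = [False, False] \<longleftrightarrow> zeros_lead b"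
  using assms
proof (induction t arbitrary: b)
  case 0
  then obtain x y where "b = [x, y]"
    by (auto simp: numeral_eq_Suc length_Suc_conv)
  then show ?case by (auto simp: zeros_lead_def)
next
  case (Suc t)
  then show ?case
    by (simp add: funpow_Suc_right zeros_lead_block_evolution del: funpow.simps)
qed

definition survival :: "real \<Rightarrow> nat \<Rightarrow> nat \<Rightarrow> real" where
  "survival p n h =
     measure_pmf.prob (replicate_pmf n (bernoulli_pmf p)) {b. stays_positive h b}"

lemma prob_replicate_bernoulli_Suc:
  assumes "p \<in> {0..1}"
  shows "measure_pmf.prob (replicate_pmf (Suc n) (bernoulli_pmf p)) A =
    p * measure_pmf.prob (replicate_pmf n (bernoulli_pmf p)) {b. True # b \<in> A} +
    (1 - p) * measure_pmf.prob (replicate_pmf n (bernoulli_pmf p)) {b. False # b \<in> A}"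
proof -
  have "replicate_pmf (Suc n) (bernoulli_pmf p) =
      bernoulli_pmf p \<bind> (\<lambda>x. map_pmf ((#) x) (replicate_pmf n (bernoulli_pmf p)))"
    by (simp add: map_pmf_def)
  then show ?thesis
    using assms
    by (simp add: measure_pmf_bind
        measure_pmf.measure_bind[where N="count_space UNIV"] measure_pmf_in_subprob_algebra vimage_def mult.commute
        del: replicate_pmf.simps)
qed

lemma survival_le_1: "survival p n h \<le> 1"
  by (simp add: survival_def)

lemma survival_nonneg: "0 \<le> survival p n h"
  by (simp add: survival_def)

lemma survival_height_0 [simp]: "survival p n 0 = 0"
  by (simp add: survival_def)

lemma survival_0: "0 < h \<Longrightarrow> survival p 0 h = 1"
  by (simp add: survival_def measure_return_pmf)

lemma survival_Suc:
  assumes "p \<in> {0..1}"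
  shows "survival p (Suc n) (Suc h) = p * survival p n h + (1 - p) * survival p n (h + 2)"
  using assms unfolding survival_def by (subst prob_replicate_bernoulli_Suc) simp_all

lemma preimage_prob_00_eq_survival:
  assumes "p \<in> {0..1}"
  shows "preimage_prob p t [False, False] = (1 - p) * survival p (Suc (2 * t)) 1"
proof -
  let ?M = "replicate_pmf (Suc (Suc (2 * t))) (bernoulli_pmf p)"
  have "preimage_prob p t [False, False] =
      measure_pmf.prob ?M {b. is_preimage rule184 t [False, False] b}"
    by (simp add: preimage_prob_def del: replicate_pmf.simps)
  also have "\<dots> = measure_pmf.prob ?M {b. zeros_lead b}"
  proof (rule measure_pmf.finite_measure_eq_AE)
    show "AE b in measure_pmf ?M.
      b \<in> {b. is_preimage rule184 t [False, False] b} \<longleftrightarrow> b \<in> {b. zeros_lead b}"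
      by (auto intro!: AE_pmfI simp: is_preimage_def block_evolution_funpow_eq_00_iff set_replicate_pmf
          simp del: replicate_pmf.simps)
  qed auto
  also have "\<dots> = (1 - p) * survival p (Suc (2 * t)) 1"
    using assms by (subst prob_replicate_bernoulli_Suc) (simp_all add: survival_def zeros_lead_def)
  finally show ?thesis .
qed

lemma survival_Suc_le:
  assumes "p \<in> {0..1}"
  shows "survival p (Suc n) h \<le> survival p n h"
proof (induction n arbitrary: h)
  case 0
  show ?case
    by (cases "h = 0") (simp_all add: survival_0 survival_le_1)
next
  case (Suc n)
  show ?case
  proof (cases h)
    case (Suc k)
    then show ?thesis
      unfolding Suc survival_Suc[OF assms]
      using assms Suc.IH by (intro add_mono mult_left_mono) auto
  qed simp
qed

text \<open>The left side is harmonic for the walk, vanishes at height 0 and is at most 1, so the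
  first-step recursion keeps it below the survival probability.\<close>

lemma survival_ge:
  assumes "0 \<le> p" "p < 1 / 2"
  shows "1 - (p / (1 - p)) ^ h \<le> survival p n h"
proof (induction n arbitrary: h)
  case 0
  show ?case
    using assms by (cases "h = 0") (simp_all add: survival_0)
next
  case (Suc n)
  show ?case
  proof (cases h)
    case (Suc k)
    define r where "r = p / (1 - p)"
    have r: "(1 - p) * r = p"
      using assms by (simp add: r_def)
    have martingale: "p * s + (1 - p) * (r * (r * s)) = r * s" for s
    proof -
      have "p * s + ((1 - p) * r) * (r * s) = ((1 - p) * r) * s + p * (r * s)"
        unfolding r ..
      then show ?thesis
        by (simp add: algebra_simps)
    qed
    have "1 - r ^ Suc k = p * (1 - r ^ k) + (1 - p) * (1 - r ^ (k + 2))"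
      using martingale[of "r ^ k"] by (simp add: algebra_simps)
    also have "\<dots> \<le> p * survival p n k + (1 - p) * survival p n (k + 2)"
      unfolding r_def using assms by (intro add_mono mult_left_mono Suc.IH) auto
    finally show ?thesis
      using assms by (simp add: Suc survival_Suc r_def)
  qed simp
qed

text \<open>Harmonicity makes consecutive increments of \<open>L\<close> geometric with ratio
  \<open>p / (1 - p)\<close>.\<close>

lemma harmonic_eq_geometric_sum:
  fixes L :: "nat \<Rightarrow> real"
  assumes "p < 1" and harmonic: "\<And>h. L (Suc h) = p * L h + (1 - p) * L (h + 2)"
    and "L 0 = 0"
  shows "L h = L 1 * (\<Sum>i<h. (p / (1 - p)) ^ i)"
proof -
  have "L (Suc h) - L h = L 1 * (p / (1 - p)) ^ h" for h
  proof (induction h)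
    case (Suc h)
    have "(1 - p) * (L (h + 2) - L (Suc h)) = p * (L (Suc h) - L h)"
      using harmonic[of h] by (simp add: algebra_simps)
    then have "L (h + 2) - L (Suc h) = (p / (1 - p)) * (L (Suc h) - L h)"
      using \<open>p < 1\<close> by (simp add: field_simps)
    with Suc show ?case by simp
  qed (simp add: \<open>L 0 = 0\<close>)
  then have "(\<Sum>i<h. L (Suc i) - L i) = L 1 * (\<Sum>i<h. (p / (1 - p)) ^ i)"
    by (simp add: sum_distrib_left)
  then show ?thesis
    by (simp add: sum_lessThan_telescope \<open>L 0 = 0\<close>)
qed

lemma survival_limit:
  assumes "p \<in> {0..1}"
  shows "(\<lambda>n. (1 - p) * survival p n 1) \<longlonglongrightarrow> (if p < 1 / 2 then 1 - 2 * p else 0)"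
proof -
  have "\<exists>l. (\<lambda>n. survival p n h) \<longlonglongrightarrow> l" for h
    using decseq_convergent[of "\<lambda>n. survival p n h" 0] survival_Suc_le[OF assms]
    by (metis decseq_SucI survival_nonneg)
  then obtain L where L: "\<And>h. (\<lambda>n. survival p n h) \<longlonglongrightarrow> L h"
    by metis
  have L_0: "L 0 = 0"
    using L[of 0] by (simp add: LIMSEQ_const_iff)
  have L_le_1: "L h \<le> 1" for h
    using L[of h] by (rule LIMSEQ_le_const2) (auto simp: survival_le_1)
  have L_nonneg: "0 \<le> L h" for h
    using L[of h] by (rule LIMSEQ_le_const) (auto simp: survival_nonneg)
  have harmonic: "L (Suc h) = p * L h + (1 - p) * L (h + 2)" for h
  proof (rule LIMSEQ_unique)
    show "(\<lambda>n. survival p (Suc n) (Suc h)) \<longlonglongrightarrow> L (Suc h)"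
      using L by (rule LIMSEQ_Suc)
    show "(\<lambda>n. survival p (Suc n) (Suc h)) \<longlonglongrightarrow> p * L h + (1 - p) * L (h + 2)"
      unfolding survival_Suc[OF assms] by (intro tendsto_intros L)
  qed
  define r where "r = p / (1 - p)"
  have L_eq: "L h = L 1 * (\<Sum>i<h. r ^ i)" if "p < 1" for h
    unfolding r_def using that harmonic L_0 by (rule harmonic_eq_geometric_sum)
  have "(1 - p) * L 1 = (if p < 1 / 2 then 1 - 2 * p else 0)"
  proof (cases "p < 1 / 2")
    case True
    then have r: "0 \<le> r" "r < 1"
      using assms by (auto simp: r_def field_simps)
    \<comment> \<open>Letting the height tend to infinity turns \<open>L h \<le> 1\<close> into the
      upper bound \<open>L 1 \<le> 1 - r\<close>.\<close>
    have "(\<lambda>h. L h) \<longlonglongrightarrow> L 1 * (1 / (1 - r))"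
      using tendsto_mult[OF tendsto_const geometric_sums[of r, unfolded sums_def]] r True
      by (subst L_eq) auto
    then have "L 1 * (1 / (1 - r)) \<le> 1"
      by (rule LIMSEQ_le_const2) (auto simp: L_le_1)
    moreover have "1 - r ^ 1 \<le> L 1"
      using L[of 1] unfolding r_def
      by (rule LIMSEQ_le_const) (use survival_ge[of p 1] True assms in auto)
    ultimately have "L 1 = 1 - r"
      using r by (simp add: field_simps)
    then show ?thesis
      using True by (simp add: r_def field_simps)
  next
    case False
    have "L 1 = 0" if "p < 1"
    proof (rule ccontr)
      assume "L 1 \<noteq> 0"
      with L_nonneg[of 1] have "0 < L 1" by simp
      \<comment> \<open>As \<open>1 \<le> r\<close>, the geometric sum up to \<open>m\<close> is at
        least \<open>m\<close>, which would force \<open>L m\<close> above 1.\<close>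
      then obtain m :: nat where m: "1 < of_nat m * L 1"
        using reals_Archimedean3 by blast
      have "1 \<le> r"
        using False that by (simp add: r_def field_simps)
      then have "(\<Sum>i<m. 1) \<le> (\<Sum>i<m. r ^ i)"
        by (intro sum_mono) simp
      then have "of_nat m * L 1 \<le> L m"
        using \<open>0 < L 1\<close> L_eq[OF that, of m] by (simp add: mult.commute)
      with m L_le_1[of m] show False by simp
    qed
    then show ?thesis
      \<comment> \<open>At \<open>p = 1\<close> the factor \<open>1 - p\<close> vanishes.\<close>
      using False assms by (cases "p = 1") auto
  qed
  then show ?thesis
    using tendsto_mult[OF tendsto_const[of "1 - p"] L[of 1]] by simp
qed

theorem mainTheorem3:
  fixes p :: real
  assumes "p \<in> {0..1}"
  shows "(\<lambda>t. preimage_prob p t [False, False])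
           \<longlonglongrightarrow> (if p < 1 / 2 then 1 - 2 * p else 0)"
proof -
  \<comment> \<open>After the first zero, \<open>2 * t + 1\<close> cells remain, so only odd times
    occur.\<close>
  have "strict_mono (\<lambda>t::nat. Suc (2 * t))"
    by (simp add: strict_mono_def)
  from LIMSEQ_subseq_LIMSEQ[OF survival_limit[OF assms] this] show ?thesis
    by (simp add: preimage_prob_00_eq_survival[OF assms] comp_def)
qed

end
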